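(* Let $C$ be a conjugation on a Hilbert space $\mathcal H$. Each densely defined $C$-symmetric dissipative operator $T$ on $\mathcal H$ admits a $C$-self-adjoint maximal dissipative extension on $\mathcal H$.
   Context: $\mathcal H$ is a complex Hilbert space with inner product $(\cdot,\cdot)$. A conjugation on $\mathcal H$ is an anti-linear isometric operator $C:\mathcal H\to\mathcal H$ with $C^2=I$. A linear operator $T$ on $\mathcal H$ is $C$-symmetric if $(Tx,Cy)=(x,CTy)$ for all $x,y\in\operatorname{dom}T$; for densely defined $T$ this is equivalent to $T\subseteq CT^*C$. A densely defined operator $T$ is $C$-self-adjoint if $T=CT^*C$. A linear operator $T$ is dissipative if $\operatorname{Im}(Tf,f)\ge 0$ for all $f\in\operatorname{dom}T$; it is maximal dissipative if it is dissipative and has no proper dissipative extension on $\mathcal H$. *)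

theory Defs
  imports "HOL-Analysis.Analysis"
begin

text \<open>
  The inner product is linear in the first argument and conjugate-linear in the second.
  This matters for the sign in the definition of dissipativity below.
\<close>

class complex_inner = real_normed_vector +
  fixes scaleC :: "complex \<Rightarrow> 'a \<Rightarrow> 'a" (infixr "*\<^sub>C" 75)
    and cinner :: "'a \<Rightarrow> 'a \<Rightarrow> complex"
  assumes scaleR_scaleC: "r *\<^sub>R x = complex_of_real r *\<^sub>C x"
    and scaleC_add_right: "a *\<^sub>C (x + y) = a *\<^sub>C x + a *\<^sub>C y"
    and scaleC_add_left: "(a + b) *\<^sub>C x = a *\<^sub>C x + b *\<^sub>C x"
    and scaleC_scaleC: "a *\<^sub>C (b *\<^sub>C x) = (a * b) *\<^sub>C x"
    and scaleC_one: "1 *\<^sub>C x = x"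
    and cinner_commute: "cinner x y = cnj (cinner y x)"
    and cinner_add_left: "cinner (x + y) z = cinner x z + cinner y z"
    and cinner_scaleC_left: "cinner (a *\<^sub>C x) y = a * cinner x y"
    and cinner_ge_zero: "0 \<le> Re (cinner x x)"
    and cinner_eq_zero_iff: "cinner x x = 0 \<longleftrightarrow> x = 0"
    and norm_eq_sqrt_cinner: "norm x = sqrt (Re (cinner x x))"

class chilbert_space = complex_inner + complete_space
begin

subclass banach ..

end

instantiation complex :: chilbert_space
begin

definition scaleC_complex :: "complex \<Rightarrow> complex \<Rightarrow> complex" where
  "scaleC_complex a x = a * x"

definition cinner_complex :: "complex \<Rightarrow> complex \<Rightarrow> complex" where
  "cinner_complex x y = x * cnj y"

instance
  by standard
    (auto simp: scaleC_complex_def cinner_complex_def scaleR_conv_of_real algebra_simps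
      cmod_def power2_eq_square)

end

text \<open>
  A not necessarily everywhere defined operator is a partial function \<open>T :: 'a \<rightharpoonup> 'a\<close>
  with domain \<open>dom T\<close>; \<open>T \<subseteq>\<^sub>m S\<close> says that \<open>S\<close> extends \<open>T\<close>, and equality of
  operators includes equality of their domains.
\<close>

definition linear_operator :: "('a::complex_inner \<rightharpoonup> 'a) \<Rightarrow> bool" where
  "linear_operator T \<longleftrightarrow>
     T 0 = Some 0 \<and>
     (\<forall>x y u v. T x = Some u \<longrightarrow> T y = Some v \<longrightarrow> T (x + y) = Some (u + v)) \<and>
     (\<forall>a x u. T x = Some u \<longrightarrow> T (a *\<^sub>C x) = Some (a *\<^sub>C u))"

definition densely_defined :: "('a::complex_inner \<rightharpoonup> 'a) \<Rightarrow> bool" where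
  "densely_defined T \<longleftrightarrow> closure (dom T) = UNIV"

text \<open>
  For densely defined \<open>T\<close> the element \<open>z\<close> below is unique. For other operators the
  value of \<open>adjoint_op\<close> carries no meaning, and it is not used.
\<close>

definition adjoint_op :: "('a::complex_inner \<rightharpoonup> 'a) \<Rightarrow> ('a \<rightharpoonup> 'a)" where
  "adjoint_op T = (\<lambda>y.
     if \<exists>z. \<forall>x\<in>dom T. cinner (the (T x)) y = cinner x z
     then Some (THE z. \<forall>x\<in>dom T. cinner (the (T x)) y = cinner x z)
     else None)"

definition conjugation :: "('a::complex_inner \<Rightarrow> 'a) \<Rightarrow> bool" where
  "conjugation C \<longleftrightarrow>
     (\<forall>x y. C (x + y) = C x + C y) \<and>
     (\<forall>a x. C (a *\<^sub>C x) = cnj a *\<^sub>C C x) \<and>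
     (\<forall>x. norm (C x) = norm x) \<and>
     (\<forall>x. C (C x) = x)"

text \<open>The operator \<open>C T C\<close> with its natural domain, the set of all \<open>x\<close> with \<open>C x \<in> dom T\<close>.\<close>

definition conj_op :: "('a \<Rightarrow> 'a) \<Rightarrow> ('a \<rightharpoonup> 'a) \<Rightarrow> ('a \<rightharpoonup> 'a)" where
  "conj_op C T = (\<lambda>x. map_option C (T (C x)))"

definition C_symmetric :: "('a::complex_inner \<Rightarrow> 'a) \<Rightarrow> ('a \<rightharpoonup> 'a) \<Rightarrow> bool" where
  "C_symmetric C T \<longleftrightarrow> linear_operator T \<and>
     (\<forall>x\<in>dom T. \<forall>y\<in>dom T. cinner (the (T x)) (C y) = cinner x (C (the (T y))))"

definition C_self_adjoint :: "('a::complex_inner \<Rightarrow> 'a) \<Rightarrow> ('a \<rightharpoonup> 'a) \<Rightarrow> bool" where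
  "C_self_adjoint C T \<longleftrightarrow>
     linear_operator T \<and> densely_defined T \<and> T = conj_op C (adjoint_op T)"

definition dissipative :: "('a::complex_inner \<rightharpoonup> 'a) \<Rightarrow> bool" where
  "dissipative T \<longleftrightarrow> linear_operator T \<and> (\<forall>f\<in>dom T. 0 \<le> Im (cinner (the (T f)) f))"

definition maximal_dissipative :: "('a::complex_inner \<rightharpoonup> 'a) \<Rightarrow> bool" where
  "maximal_dissipative T \<longleftrightarrow>
     dissipative T \<and> (\<forall>S. dissipative S \<longrightarrow> T \<subseteq>\<^sub>m S \<longrightarrow> S = T)"

end

theory Submission imports Defs begin

text \<open>
  The Cayley transform turns the extension problem for \<open>T\<close> into one for contractions. Since
  \<open>T\<close> is dissipative, \<open>T + \<i>\<close> is injective and \<open>V = (T - \<i>) (T + \<i>)\<^sup>-\<^sup>1\<close> is a contraction on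
  the subspace \<open>D = ran (T + \<i>)\<close>; since \<open>T\<close> is \<open>C\<close>-symmetric, so is \<open>V\<close>
  (lemma \<open>cayley_transform\<close>).
  If \<open>V\<close> extends to an everywhere defined \<open>C\<close>-symmetric contraction \<open>W\<close>, then
  \<open>S = \<i> (1 + W) (1 - W)\<^sup>-\<^sup>1\<close> extends \<open>T\<close>. The operator \<open>1 - W\<close> is injective because its range
  contains the dense set \<open>dom T\<close>: a fixed vector of the contraction \<open>W\<close> is also
  fixed by its adjoint \<open>C W C\<close>, and is therefore orthogonal to that range. Because \<open>S + \<i>\<close> is
  onto, \<open>S\<close> is maximal dissipative, and an everywhere defined symmetric \<open>W\<close> makes \<open>S\<close> not only
  \<open>C\<close>-symmetric but \<open>C\<close>-self-adjoint.

  The heart of the matter is the existence of \<open>W\<close>. A \<open>C\<close>-symmetric extension satisfies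
  \<open>W\<^sup>* = C W C\<close>, so \<open>W\<^sup>*\<close> is prescribed on \<open>C D\<close>. Thus the first column and the first row of \<open>W\<close>
  with respect to the splittings generated by \<open>D\<close> and \<open>C D\<close> are known, both are contractive, and
  Parrott's theorem fills in the remaining corner (lemma \<open>Parrott_extension\<close>). Averaging the result
  \<open>W\<^sub>0\<close> with \<open>C W\<^sub>0\<^sup>* C\<close> makes it symmetric without disturbing it on \<open>D\<close> (lemma
  \<open>symmetric_contraction_extension\<close>).

  Parrott's theorem itself reduces to one principle (lemma \<open>contractive_extension\<close>): a linear map
  from a subspace into a Hilbert space that is contractive for a positive semidefinite form extends
  with the same bound to the whole space. For the form given by the inner product this principle
  also yields orthogonal projections, and from them Riesz representation and adjoints; for the
  defect form \<open>\<parallel>x\<parallel>\<^sup>2 - \<parallel>R x\<parallel>\<^sup>2\<close> of the known row \<open>R\<close> it yields the missing corner.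
\<close>

section \<open>Complex linear algebra\<close>

interpretation complex_space: vector_space "scaleC :: complex \<Rightarrow> 'a::complex_inner \<Rightarrow> 'a"
  by unfold_locales (simp_all add: scaleC_add_right scaleC_add_left scaleC_scaleC scaleC_one)

definition csubspace :: "'a::complex_inner set \<Rightarrow> bool" where
  "csubspace D \<longleftrightarrow> 0 \<in> D \<and> (\<forall>x\<in>D. \<forall>y\<in>D. x + y \<in> D) \<and> (\<forall>a. \<forall>x\<in>D. a *\<^sub>C x \<in> D)"

definition clinear_on :: "'a::complex_inner set \<Rightarrow> ('a \<Rightarrow> 'b::complex_inner) \<Rightarrow> bool" where
  "clinear_on D A \<longleftrightarrow>
     (\<forall>x\<in>D. \<forall>y\<in>D. A (x + y) = A x + A y) \<and> (\<forall>a. \<forall>x\<in>D. A (a *\<^sub>C x) = a *\<^sub>C A x)"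

lemma csubspace_diff:
  assumes "csubspace D" "x \<in> D" "y \<in> D" shows "x - y \<in> D"
proof -
  have "x + (-1) *\<^sub>C y \<in> D" using assms unfolding csubspace_def by blast
  then show ?thesis by simp
qed

lemma clinear_on_diff:
  assumes "csubspace D" "clinear_on D A" "x \<in> D" "y \<in> D" shows "A (x - y) = A x - A y"
proof -
  have "A (x + (-1) *\<^sub>C y) = A x + (-1) *\<^sub>C A y"
    using assms unfolding csubspace_def clinear_on_def by metis
  then show ?thesis by simp
qed

lemma csubspace_UNIV [simp]: "csubspace UNIV"
  by (simp add: csubspace_def)

lemma
  assumes "clinear_on UNIV A"
  shows clinear_add: "A (x + y) = A x + A y"
    and clinear_scale: "A (a *\<^sub>C x) = a *\<^sub>C A x"
    and clinear_diff: "A (x - y) = A x - A y"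
  using assms clinear_on_diff[of UNIV A] by (simp_all add: clinear_on_def)

section \<open>Positive semidefinite forms and contractive extension\<close>

lemma discriminant_nonpos:
  fixes b c d :: real
  assumes nonneg: "\<And>t. 0 \<le> d + 2 * t * b + t\<^sup>2 * c" and c: "0 \<le> c"
  shows "b\<^sup>2 \<le> d * c"
proof (cases "c = 0")
  case True
  have "b = 0"
  proof (rule ccontr)
    assume "b \<noteq> 0"
    then have "2 * (- (d + 1) / (2 * b)) * b = - (d + 1)" by simp
    moreover have "0 \<le> d + 2 * (- (d + 1) / (2 * b)) * b"
      using nonneg[of "- (d + 1) / (2 * b)"] True by simp
    ultimately show False by linarith
  qed
  then show ?thesis using True by simp
next
  case False
  have "0 \<le> d + 2 * (- b / c) * b + (- b / c)\<^sup>2 * c" by (rule nonneg)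
  also have "\<dots> = d - b\<^sup>2 / c" using False by (simp add: power2_eq_square field_simps)
  finally show ?thesis using False c by (simp add: field_simps)
qed

text \<open>
  The form may degenerate: the defect form of a contraction vanishes on every vector whose norm
  the contraction preserves.
\<close>

locale semi_inner =
  fixes q :: "'a::complex_inner \<Rightarrow> 'a \<Rightarrow> complex"
  assumes add_left: "q (x + y) z = q x z + q y z"
    and scale_left: "q (a *\<^sub>C x) y = a * q x y"
    and commute: "q x y = cnj (q y x)"
    and nonneg: "0 \<le> Re (q x x)"
begin

lemma add_right: "q z (x + y) = q z x + q z y"
  by (metis add_left commute complex_cnj_add)

lemma scale_right: "q y (a *\<^sub>C x) = cnj a * q y x"
  by (metis scale_left commute complex_cnj_mult)

lemma minus_left: "q (- x) y = - q x y"
  using scale_left[of "-1" x y] by simp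

lemma minus_right: "q y (- x) = - q y x"
  using scale_right[of y "-1" x] by simp

lemma diff_left: "q (x - y) z = q x z - q y z"
  using add_left[of x "- y" z] by (simp add: minus_left)

lemma diff_right: "q z (x - y) = q z x - q z y"
  using add_right[of z x "- y"] by (simp add: minus_right)

lemma zero_left [simp]: "q 0 y = 0"
  using scale_left[of 0 0 y] by simp

lemma zero_right [simp]: "q y 0 = 0"
  using scale_right[of y 0 0] by simp

lemmas bilinear = add_left add_right diff_left diff_right minus_left minus_right
  scale_left scale_right

lemma Re_commute: "Re (q x y) = Re (q y x)"
  using arg_cong[OF commute[of x y], of Re] by simp

definition seminorm :: "'a \<Rightarrow> real" where
  "seminorm x = sqrt (Re (q x x))"

lemma seminorm_nonneg [simp]: "0 \<le> seminorm x"
  by (simp add: seminorm_def nonneg)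

lemma seminorm_square: "(seminorm x)\<^sup>2 = Re (q x x)"
  by (simp add: seminorm_def nonneg)

lemma expand_line:
  "Re (q (x + complex_of_real t *\<^sub>C y) (x + complex_of_real t *\<^sub>C y))
    = Re (q x x) + 2 * t * Re (q x y) + t\<^sup>2 * Re (q y y)"
  using Re_commute[of x y] by (simp add: bilinear power2_eq_square algebra_simps)

lemma Re_Cauchy_Schwarz: "\<bar>Re (q x y)\<bar> \<le> seminorm x * seminorm y"
proof -
  have "(Re (q x y))\<^sup>2 \<le> Re (q x x) * Re (q y y)"
    by (rule discriminant_nonpos) (simp_all add: nonneg flip: expand_line)
  then have "\<bar>Re (q x y)\<bar>\<^sup>2 \<le> (seminorm x * seminorm y)\<^sup>2"
    by (simp add: power_mult_distrib seminorm_square)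
  then show ?thesis by (rule power2_le_imp_le) simp
qed

lemma seminorm_scale: "seminorm (a *\<^sub>C x) = cmod a * seminorm x"
proof -
  have "q (a *\<^sub>C x) (a *\<^sub>C x) = complex_of_real ((cmod a)\<^sup>2) * q x x"
    by (simp add: bilinear complex_norm_square del: of_real_power)
  then have "Re (q (a *\<^sub>C x) (a *\<^sub>C x)) = (cmod a)\<^sup>2 * Re (q x x)" by simp
  then show ?thesis by (simp add: seminorm_def real_sqrt_mult)
qed

lemma Cauchy_Schwarz: "cmod (q x y) \<le> seminorm x * seminorm y"
proof (cases "q x y = 0")
  case False
  let ?z = "q x y"
  have "cnj ?z * ?z = complex_of_real ((cmod ?z)\<^sup>2)"
    by (metis complex_norm_square mult.commute)
  then have "(cmod ?z)\<^sup>2 = Re (q (cnj ?z *\<^sub>C x) y)" by (simp add: bilinear)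
  also have "\<dots> \<le> cmod ?z * seminorm x * seminorm y"
    using Re_Cauchy_Schwarz[of "cnj ?z *\<^sub>C x" y] by (simp add: seminorm_scale)
  finally have "cmod ?z * cmod ?z \<le> cmod ?z * (seminorm x * seminorm y)"
    by (simp add: power2_eq_square mult.assoc)
  then show ?thesis using False by simp
qed simp

end

interpretation cinner: semi_inner "cinner :: 'a::complex_inner \<Rightarrow> 'a \<Rightarrow> complex"
  rewrites "semi_inner.seminorm cinner = (norm :: 'a \<Rightarrow> real)"
proof -
  show "semi_inner (cinner :: 'a \<Rightarrow> 'a \<Rightarrow> complex)"
    by unfold_locales (rule cinner_add_left cinner_scaleC_left cinner_commute cinner_ge_zero)+
  then show "semi_inner.seminorm cinner = (norm :: 'a \<Rightarrow> real)"
    by (intro ext) (simp add: semi_inner.seminorm_def norm_eq_sqrt_cinner)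
qed

lemma bounded_linear_scaleC: "bounded_linear ((*\<^sub>C) a :: 'a::complex_inner \<Rightarrow> 'a)"
  by (rule bounded_linear_intro[where K = "cmod a"])
    (simp_all add: scaleC_add_right scaleR_scaleC scaleC_scaleC cinner.seminorm_scale mult.commute)

context semi_inner
begin

text \<open>
  When \<open>e\<close> tends to \<open>0\<close>, \<open>f\<close> plays the part of the orthogonal projection of \<open>x\<close> onto \<open>D\<close>, which need
  not exist, as \<open>q\<close> may be degenerate and the space incomplete for it. A bound on the
  functional \<open>q (x - f)\<close> is used instead of near-minimality of the distance from \<open>x\<close> to \<open>f\<close>, because
  it is compatible with sums and scalar multiples.
\<close>

definition near_projection :: "'a set \<Rightarrow> real \<Rightarrow> 'a \<Rightarrow> 'a \<Rightarrow> bool" where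
  "near_projection D e x f \<longleftrightarrow> f \<in> D \<and> (\<forall>g\<in>D. \<bar>Re (q (x - f) g)\<bar> \<le> e * seminorm g)"

text \<open>
  A point \<open>f\<close> whose squared distance to \<open>x\<close> is within \<open>e\<^sup>2\<close> of the infimum works: moving
  from \<open>f\<close> along a line in \<open>D\<close> gains at most \<open>e\<^sup>2\<close>, which bounds the discriminant.
\<close>

lemma near_projection_exists:
  assumes D: "csubspace D" and e: "e > 0"
  shows "\<exists>f. near_projection D e x f"
proof -
  let ?I = "(\<lambda>f. Re (q (x - f) (x - f))) ` D"
  have ne: "?I \<noteq> {}" and bdd: "bdd_below ?I"
    using D nonneg by (auto simp: csubspace_def intro!: bdd_belowI[of _ 0])
  have "Inf ?I < Inf ?I + e\<^sup>2" using e by simp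
  then obtain f where f: "f \<in> D" and less: "Re (q (x - f) (x - f)) < Inf ?I + e\<^sup>2"
    using cInf_lessD[OF ne] by blast
  have "\<bar>Re (q (x - f) g)\<bar> \<le> e * seminorm g" if g: "g \<in> D" for g
  proof -
    have "(Re (q (x - f) g))\<^sup>2 \<le> e\<^sup>2 * Re (q g g)"
    proof (rule discriminant_nonpos)
      fix t :: real
      let ?h = "f - complex_of_real t *\<^sub>C g"
      have "?h \<in> D" using D f g csubspace_diff unfolding csubspace_def by blast
      then have "Inf ?I \<le> Re (q (x - ?h) (x - ?h))" using bdd by (intro cInf_lower) auto
      also have "x - ?h = (x - f) + complex_of_real t *\<^sub>C g" by simp
      finally show "0 \<le> e\<^sup>2 + 2 * t * Re (q (x - f) g) + t\<^sup>2 * Re (q g g)"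
        using less unfolding expand_line by linarith
    qed (rule nonneg)
    then have "\<bar>Re (q (x - f) g)\<bar>\<^sup>2 \<le> (e * seminorm g)\<^sup>2"
      by (simp add: power_mult_distrib seminorm_square)
    then show ?thesis by (rule power2_le_imp_le) (use e in simp)
  qed
  then show ?thesis using f unfolding near_projection_def by blast
qed

lemma near_projection_add:
  assumes "csubspace D" "near_projection D d x f" "near_projection D e y g"
  shows "near_projection D (d + e) (x + y) (f + g)"
proof -
  have "\<bar>Re (q (x + y - (f + g)) h)\<bar> \<le> (d + e) * seminorm h" if "h \<in> D" for h
  proof -
    have "\<bar>Re (q (x - f) h)\<bar> \<le> d * seminorm h" "\<bar>Re (q (y - g) h)\<bar> \<le> e * seminorm h"
      using assms that by (auto simp: near_projection_def)
    then show ?thesis by (simp add: bilinear algebra_simps)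
  qed
  then show ?thesis using assms unfolding near_projection_def csubspace_def by blast
qed

lemma near_projection_scale:
  assumes D: "csubspace D" and f: "near_projection D e x f"
  shows "near_projection D (cmod a * e) (a *\<^sub>C x) (a *\<^sub>C f)"
proof -
  have "\<bar>Re (q (a *\<^sub>C x - a *\<^sub>C f) h)\<bar> \<le> (cmod a * e) * seminorm h" if h: "h \<in> D" for h
  proof -
    have "cnj a *\<^sub>C h \<in> D" using D h by (simp add: csubspace_def)
    then have "\<bar>Re (q (x - f) (cnj a *\<^sub>C h))\<bar> \<le> e * seminorm (cnj a *\<^sub>C h)"
      using f by (simp add: near_projection_def)
    then show ?thesis by (simp add: bilinear seminorm_scale algebra_simps)
  qed
  then show ?thesis using D f unfolding near_projection_def csubspace_def by blast
qed

lemma near_projection_diff: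
  assumes "csubspace D" "near_projection D d x f" "near_projection D e y g"
  shows "near_projection D (d + e) (x - y) (f - g)"
  using near_projection_add[OF assms(1,2) near_projection_scale[OF assms(1,3), of "-1"]] by simp

lemma near_projection_seminorm:
  assumes "near_projection D e x f" "0 \<le> e"
  shows "seminorm f \<le> seminorm x + e"
proof (cases "seminorm f = 0")
  case False
  have "(seminorm f)\<^sup>2 = Re (q x f) - Re (q (x - f) f)"
    by (simp add: seminorm_square bilinear)
  also have "\<dots> \<le> seminorm x * seminorm f + e * seminorm f"
    using Re_Cauchy_Schwarz[of x f] assms(1) unfolding near_projection_def by (smt (verit))
  finally have "seminorm f * seminorm f \<le> (seminorm x + e) * seminorm f"
    by (simp add: power2_eq_square algebra_simps)
  then show ?thesis using False seminorm_nonneg[of f] by (simp add: mult_le_cancel_right)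
qed (use assms in simp)

text \<open>
  The extension is \<open>A\<close> composed with the \<open>q\<close>-orthogonal projection onto \<open>D\<close>, understood as the limit
  of \<open>A\<close> along near-projections. Two near-projections of the same vector differ by a vector of small
  seminorm, so the limit exists and is independent of the choice; linearity follows because sums and
  multiples of near-projections are near-projections.
\<close>

lemma contractive_extension:
  fixes A :: "'a \<Rightarrow> 'b::chilbert_space"
  assumes D: "csubspace D" and A: "clinear_on D A"
    and bound: "\<And>f. f \<in> D \<Longrightarrow> norm (A f) \<le> seminorm f"
  obtains B where "clinear_on UNIV B" "\<And>f. f \<in> D \<Longrightarrow> B f = A f"
    "\<And>x. norm (B x) \<le> seminorm x" "\<And>x. B x \<in> closure (A ` D)"
proof -
  define e where "e n = inverse (real (Suc n))" for n
  have e_pos: "e n > 0" for n by (simp add: e_def)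
  have e_lim: "e \<longlonglongrightarrow> 0" unfolding e_def by (rule LIMSEQ_inverse_real_of_nat)
  obtain p where p: "\<And>n x. near_projection D (e n) x (p n x)"
    using near_projection_exists[OF D e_pos] by metis
  have pD: "p n x \<in> D" for n x using p unfolding near_projection_def by blast
  have zero: "norm (A f) \<le> d" if "near_projection D d 0 f" "0 \<le> d" for d f
    using near_projection_seminorm[OF that] bound[of f] that
    by (simp add: near_projection_def seminorm_def[of 0])
  have "convergent (\<lambda>n. A (p n x))" for x
  proof (rule Cauchy_convergent, rule metric_CauchyI)
    fix r :: real assume "r > 0"
    then have "\<forall>\<^sub>F n in sequentially. e n < r / 2"
      using order_tendstoD(2)[OF e_lim, of "r / 2"] by simp
    then obtain N where N: "\<And>n. n \<ge> N \<Longrightarrow> e n < r / 2"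
      unfolding eventually_sequentially by blast
    have "dist (A (p m x)) (A (p n x)) < r" if "m \<ge> N" "n \<ge> N" for m n
    proof -
      have "norm (A (p m x - p n x)) \<le> e m + e n"
        using zero near_projection_diff[OF D p[of m x] p[of n x]] e_pos[of m] e_pos[of n] by simp
      then show ?thesis using N[OF that(1)] N[OF that(2)]
        by (simp add: dist_norm clinear_on_diff[OF D A pD pD])
    qed
    then show "\<exists>N. \<forall>m\<ge>N. \<forall>n\<ge>N. dist (A (p m x)) (A (p n x)) < r" by blast
  qed
  then obtain B where B: "\<And>x. (\<lambda>n. A (p n x)) \<longlonglongrightarrow> B x"
    unfolding convergent_def by metis
  \<comment> \<open>the factor \<open>c\<close> absorbs the loss of accuracy for sums and scalar multiples\<close>
  have B_eq: "B x = z"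
    if lim: "(\<lambda>n. A (f n)) \<longlonglongrightarrow> z" and near: "\<And>n. near_projection D (c * e n) x (f n)" and c: "c \<ge> 0"
    for x z f c
  proof -
    have "(\<lambda>n. A (p n x) - A (f n)) \<longlonglongrightarrow> 0"
    proof (rule Lim_null_comparison)
      have "norm (A (p n x) - A (f n)) \<le> e n + c * e n" for n
      proof -
        have "f n \<in> D" using near unfolding near_projection_def by blast
        then show ?thesis
          using zero[of "e n + c * e n" "p n x - f n"] near_projection_diff[OF D p[of n x] near[of n]]
            clinear_on_diff[OF D A pD] e_pos[of n] c by simp
      qed
      then show "\<forall>\<^sub>F n in sequentially. norm (A (p n x) - A (f n)) \<le> e n + c * e n" by simp
      show "(\<lambda>n. e n + c * e n) \<longlonglongrightarrow> 0" using e_lim by (auto intro!: tendsto_eq_intros)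
    qed
    moreover have "(\<lambda>n. A (p n x) - A (f n)) \<longlonglongrightarrow> B x - z" by (intro tendsto_diff B lim)
    ultimately have "B x - z = 0" using LIMSEQ_unique by blast
    then show ?thesis by simp
  qed
  show ?thesis
  proof
    have "B (x + y) = B x + B y" for x y
    proof (rule B_eq)
      have "(\<lambda>n. A (p n x) + A (p n y)) \<longlonglongrightarrow> B x + B y" by (intro tendsto_add B)
      then show "(\<lambda>n. A (p n x + p n y)) \<longlonglongrightarrow> B x + B y" using A pD by (simp add: clinear_on_def)
      show "near_projection D (2 * e n) (x + y) (p n x + p n y)" for n
        using near_projection_add[OF D p[of n x] p[of n y]] by simp
    qed simp
    moreover have "B (a *\<^sub>C x) = a *\<^sub>C B x" for a x
    proof (rule B_eq)
      have "(\<lambda>n. a *\<^sub>C A (p n x)) \<longlonglongrightarrow> a *\<^sub>C B x"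
        by (rule bounded_linear.tendsto[OF bounded_linear_scaleC B])
      then show "(\<lambda>n. A (a *\<^sub>C p n x)) \<longlonglongrightarrow> a *\<^sub>C B x" using A pD by (simp add: clinear_on_def)
      show "near_projection D (cmod a * e n) (a *\<^sub>C x) (a *\<^sub>C p n x)" for n
        by (rule near_projection_scale[OF D p])
    qed simp
    ultimately show "clinear_on UNIV B" by (simp add: clinear_on_def)
    show "B f = A f" if "f \<in> D" for f
      by (rule B_eq[where f = "\<lambda>_. f" and c = 0])
        (use that in \<open>simp_all add: near_projection_def\<close>)
    show "norm (B x) \<le> seminorm x" for x
    proof (rule LIMSEQ_le)
      show "(\<lambda>n. norm (A (p n x))) \<longlonglongrightarrow> norm (B x)" by (intro tendsto_norm B)
      show "(\<lambda>n. seminorm x + e n) \<longlonglongrightarrow> seminorm x" using e_lim by (auto intro!: tendsto_eq_intros)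
      have "norm (A (p n x)) \<le> seminorm x + e n" for n
        using bound[OF pD] near_projection_seminorm[OF p] e_pos[of n] by (meson less_imp_le order_trans)
      then show "\<exists>N. \<forall>n\<ge>N. norm (A (p n x)) \<le> seminorm x + e n" by blast
    qed
    show "B x \<in> closure (A ` D)" for x
      unfolding closure_sequential
      by (rule exI[of _ "\<lambda>n. A (p n x)"]) (use B pD in auto)
  qed
qed

end


section \<open>Hilbert space geometry\<close>

lemma norm_add_square:
  "(norm (x + y))\<^sup>2 = (norm x)\<^sup>2 + 2 * Re (cinner x y) + (norm (y::'a::complex_inner))\<^sup>2"
  using cinner.expand_line[of x 1 y] by (simp add: cinner.seminorm_square)

lemma norm_diff_square:
  "(norm (x - y))\<^sup>2 = (norm x)\<^sup>2 - 2 * Re (cinner x y) + (norm (y::'a::complex_inner))\<^sup>2"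
  using norm_add_square[of x "- y"] by (simp add: cinner.bilinear)

lemma cinner_ext:
  fixes x y :: "'a::complex_inner"
  assumes "\<And>z. cinner x z = cinner y z" shows "x = y"
proof -
  have "cinner (x - y) (x - y) = 0" using assms by (simp add: cinner.diff_left)
  then show ?thesis by (simp add: cinner_eq_zero_iff)
qed

lemma cinner_ext_left:
  fixes x y :: "'a::complex_inner"
  assumes "\<And>z. cinner z x = cinner z y" shows "x = y"
  by (rule cinner_ext) (metis assms cinner_commute)

lemma orthogonal_closure:
  fixes y :: "'a::complex_inner"
  assumes "\<And>x. x \<in> S \<Longrightarrow> cinner x y = 0" "z \<in> closure S"
  shows "cinner z y = 0"
proof -
  obtain s where s: "\<And>n. s n \<in> S" "s \<longlonglongrightarrow> z" using assms(2) unfolding closure_sequential by blast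
  have "bounded_linear (\<lambda>x. cinner x y)"
    by (rule bounded_linear_intro[where K = "norm y"])
      (simp_all add: cinner.bilinear scaleR_scaleC scaleC_complex_def cinner.Cauchy_Schwarz)
  then have "(\<lambda>n. cinner (s n) y) \<longlonglongrightarrow> cinner z y" using s(2) by (rule bounded_linear.tendsto)
  then show ?thesis using assms(1) s(1) by (simp add: LIMSEQ_const_iff)
qed

text \<open>
  Extend the identity of \<open>D\<close> contractively. The result \<open>P\<close> satisfies \<open>\<parallel>P x + t f\<parallel> \<le> \<parallel>x + t f\<parallel>\<close> for
  \<open>f \<in> D\<close> and all real \<open>t\<close>; the quadratic terms in \<open>t\<close> cancel, so the linear ones must agree.
\<close>

lemma orthogonal_projection:
  fixes D :: "'a::chilbert_space set"
  assumes D: "csubspace D"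
  obtains P where "clinear_on UNIV P" "\<And>x. norm (P x) \<le> norm x" "\<And>x. P x \<in> closure D"
    "\<And>x f. f \<in> D \<Longrightarrow> cinner (P x) f = cinner x f"
proof -
  obtain P where lin: "clinear_on UNIV P" and id: "\<And>f. f \<in> D \<Longrightarrow> P f = f"
    and norm: "\<And>x. norm (P x) \<le> norm x" and cl: "\<And>x. P x \<in> closure D"
  proof (rule cinner.contractive_extension[OF D, of "\<lambda>x. x"])
    show "clinear_on D (\<lambda>x. x)" by (simp add: clinear_on_def)
  qed simp_all
  have Re: "Re (cinner (P x) f) = Re (cinner x f)" if f: "f \<in> D" for x f
  proof -
    have "(Re (cinner x f - cinner (P x) f))\<^sup>2 \<le> ((norm x)\<^sup>2 - (norm (P x))\<^sup>2) * 0"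
    proof (rule discriminant_nonpos)
      fix t :: real
      have tf: "complex_of_real t *\<^sub>C f \<in> D" using D f by (simp add: csubspace_def)
      have "(norm (P (x + complex_of_real t *\<^sub>C f)))\<^sup>2 \<le> (norm (x + complex_of_real t *\<^sub>C f))\<^sup>2"
        by (intro power_mono norm) simp
      then show "0 \<le> (norm x)\<^sup>2 - (norm (P x))\<^sup>2 + 2 * t * Re (cinner x f - cinner (P x) f) + t\<^sup>2 * 0"
        by (simp add: clinear_add[OF lin] id[OF tf] norm_add_square cinner.bilinear algebra_simps)
    qed simp
    then show ?thesis by simp
  qed
  have "cinner (P x) f = cinner x f" if f: "f \<in> D" for x f
  proof (rule complex_eqI)
    have "\<i> *\<^sub>C f \<in> D" using D f by (simp add: csubspace_def)
    then show "Im (cinner (P x) f) = Im (cinner x f)"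
      using Re[of "\<i> *\<^sub>C f" x] by (simp add: cinner.bilinear)
  qed (rule Re[OF f])
  then show ?thesis using that lin norm cl by blast
qed

text \<open>
  The kernel has codimension at most one, and its orthogonal complement, which is reached by
  subtracting from a vector its projection onto the kernel, spans the rest.
\<close>

lemma Riesz_representation:
  fixes l :: "'a::chilbert_space \<Rightarrow> complex"
  assumes lin: "clinear_on UNIV l" and bound: "\<And>x. norm (l x) \<le> K * norm x"
  obtains z where "\<And>x. l x = cinner x z"
proof (cases "\<forall>x. l x = 0")
  case True
  then show ?thesis using that[of 0] by simp
next
  case False
  then obtain v where v: "l v \<noteq> 0" by blast
  let ?N = "{x. l x = 0}"
  have l0: "l 0 = 0" using clinear_diff[OF lin, of 0 0] by simp
  have N: "csubspace ?N"
    using l0 by (simp add: csubspace_def clinear_add[OF lin] clinear_scale[OF lin] scaleC_complex_def)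
  have "bounded_linear l"
    by (rule bounded_linear_intro[where K = K])
      (use bound in \<open>simp_all add: clinear_add[OF lin] clinear_scale[OF lin] scaleR_scaleC mult.commute\<close>)
  then have closed: "closed ?N"
    by (intro closed_Collect_eq continuous_intros linear_continuous_on) 
  obtain P where P: "\<And>x. P x \<in> closure ?N" "\<And>x f. f \<in> ?N \<Longrightarrow> cinner (P x) f = cinner x f"
    using orthogonal_projection[OF N] by metis
  define e where "e = v - P v"
  have "P v \<in> ?N" using P(1)[of v] closed by simp
  then have le: "l e = l v" by (simp add: e_def clinear_diff[OF lin])
  have orth: "cinner e f = 0" if "f \<in> ?N" for f
    using P(2)[OF that] by (simp add: e_def cinner.bilinear)
  have "l e \<noteq> 0" using le v by simp
  then have "e \<noteq> 0" using l0 by auto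
  then have ee: "cinner e e \<noteq> 0" by (simp add: cinner_eq_zero_iff)
  have "l x = cinner x (cnj (l e / cinner e e) *\<^sub>C e)" for x
  proof -
    have "l x *\<^sub>C e - l e *\<^sub>C x \<in> ?N"
      by (simp add: clinear_diff[OF lin] clinear_scale[OF lin] scaleC_complex_def)
    then have "cinner (l x *\<^sub>C e - l e *\<^sub>C x) e = 0" using orth cinner_commute[of _ e] by simp
    then show ?thesis using ee by (simp add: cinner.bilinear field_simps)
  qed
  then show ?thesis using that by blast
qed

lemma contraction_adjoint:
  fixes A :: "'a::chilbert_space \<Rightarrow> 'b::complex_inner"
  assumes lin: "clinear_on UNIV A" and contr: "\<And>x. norm (A x) \<le> norm x"
  obtains B where "clinear_on UNIV B" "\<And>x. norm (B x) \<le> norm x"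
    "\<And>x y. cinner (A x) y = cinner x (B y)"
proof -
  have "\<exists>z. \<forall>x. cinner (A x) y = cinner x z" for y
  proof -
    have lin_y: "clinear_on UNIV (\<lambda>x. cinner (A x) y)"
      by (simp add: clinear_on_def clinear_add[OF lin] clinear_scale[OF lin] cinner.bilinear scaleC_complex_def)
    have bound_y: "norm (cinner (A x) y) \<le> norm y * norm x" for x
      using cinner.Cauchy_Schwarz[of "A x" y] mult_right_mono[OF contr[of x] norm_ge_zero[of y]]
      by (simp add: mult.commute)
    show ?thesis by (rule Riesz_representation[OF lin_y bound_y]) blast
  qed
  then obtain B where B: "\<And>x y. cinner (A x) y = cinner x (B y)" by metis
  have "B (x + y) = B x + B y" for x y
    by (rule cinner_ext_left) (simp add: cinner.add_right flip: B)
  moreover have "B (a *\<^sub>C x) = a *\<^sub>C B x" for a x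
    by (rule cinner_ext_left) (simp add: cinner.scale_right flip: B)
  ultimately have "clinear_on UNIV B" by (simp add: clinear_on_def)
  moreover have "norm (B y) \<le> norm y" for y
  proof (cases "B y = 0")
    case False
    have "norm (B y) * norm (B y) = Re (cinner (A (B y)) y)"
      by (simp add: B power2_eq_square flip: cinner.seminorm_square)
    also have "\<dots> \<le> norm (A (B y)) * norm y" using cinner.Re_Cauchy_Schwarz[of "A (B y)" y] by simp
    also have "\<dots> \<le> norm (B y) * norm y" by (intro mult_right_mono contr) simp
    finally show ?thesis using False by simp
  qed simp
  ultimately show ?thesis using that B by blast
qed

section \<open>Contractions symmetric under a conjugation\<close>

lemma
  assumes "conjugation C"
  shows conjugation_add: "C (x + y) = C x + C y"
    and conjugation_scale: "C (a *\<^sub>C x) = cnj a *\<^sub>C C x"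
    and conjugation_norm: "norm (C x) = norm x"
    and conjugation_involution: "C (C x) = x"
  using assms by (simp_all add: conjugation_def)

lemma conjugation_diff:
  assumes "conjugation C" shows "C (x - y) = C x - C y"
  using conjugation_add[OF assms, of "x - y" y] by simp

lemma cinner_conjugation:
  fixes C :: "'a::complex_inner \<Rightarrow> 'a"
  assumes C: "conjugation C"
  shows "cinner (C x) (C y) = cinner y x"
proof -
  have Re: "Re (cinner (C x) (C y)) = Re (cinner x y)" for x y
    using norm_add_square[of x y] norm_add_square[of "C x" "C y"]
    by (simp add: conjugation_norm[OF C] flip: conjugation_add[OF C])
  have "Im (cinner (C x) (C y)) = - Im (cinner x y)"
    using Re[of "\<i> *\<^sub>C x" y] by (simp add: conjugation_scale[OF C] cinner.bilinear)
  then have "cinner (C x) (C y) = cnj (cinner x y)" using Re by (simp add: complex_eq_iff)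
  then show ?thesis by (metis cinner_commute)
qed

lemma cinner_conjugation_swap:
  fixes C :: "'a::complex_inner \<Rightarrow> 'a"
  assumes C: "conjugation C"
  shows "cinner x (C y) = cinner y (C x)"
  using cinner_conjugation[OF C, of "C x" y] by (simp add: conjugation_involution[OF C])

lemma csubspace_conjugation:
  assumes C: "conjugation C" and D: "csubspace D"
  shows "csubspace (C ` D)"
proof -
  have "C 0 = 0" using conjugation_norm[OF C, of 0] by simp
  then have "0 \<in> C ` D" using D by (force simp: csubspace_def)
  moreover have "a *\<^sub>C C x = C (cnj a *\<^sub>C x)" for a x by (simp add: conjugation_scale[OF C])
  ultimately show ?thesis
    using D by (auto simp: csubspace_def conjugation_add[OF C, symmetric] simp del: image_iff)
qed

text \<open>
  The last condition says that the adjoint of \<open>W\<close> maps \<open>C f\<close> to \<open>C (V f)\<close>. It determines the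
  component \<open>R\<close> of \<open>W\<close> in the closure of \<open>C D\<close>. On \<open>D\<close> the other component must be \<open>V - R\<close>,
  which takes values orthogonal to \<open>C D\<close>, so that \<open>\<parallel>V f\<parallel>\<^sup>2 = \<parallel>R f\<parallel>\<^sup>2 + \<parallel>V f - R f\<parallel>\<^sup>2\<close>.
  Contractivity of \<open>V\<close> therefore says precisely that \<open>V - R\<close> is contractive for the form
  \<open>\<parallel>f\<parallel>\<^sup>2 - \<parallel>R f\<parallel>\<^sup>2\<close>, and a contractive extension \<open>B\<close> of \<open>V - R\<close> for this form makes \<open>R + B\<close> a
  contraction.
\<close>

lemma Parrott_extension:
  fixes C :: "'a::chilbert_space \<Rightarrow> 'a"
  assumes C: "conjugation C" and D: "csubspace D" and V: "clinear_on D V"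
    and contr: "\<And>f. f \<in> D \<Longrightarrow> norm (V f) \<le> norm f"
    and sym: "\<And>f g. f \<in> D \<Longrightarrow> g \<in> D \<Longrightarrow> cinner (V f) (C g) = cinner f (C (V g))"
  obtains W where "clinear_on UNIV W" "\<And>x. norm (W x) \<le> norm x" "\<And>f. f \<in> D \<Longrightarrow> W f = V f"
    "\<And>x f. f \<in> D \<Longrightarrow> cinner (W x) (C f) = cinner x (C (V f))"
proof -
  note CC = conjugation_involution[OF C]
  have CD: "csubspace (C ` D)" by (rule csubspace_conjugation[OF C D])
  \<comment> \<open>the prescribed adjoint on \<open>C D\<close>; the projected adjoint of its extension \<open>U\<close> is the row \<open>R\<close>\<close>
  obtain U where U: "clinear_on UNIV U" "\<And>x. norm (U x) \<le> norm x" "\<And>h. h \<in> C ` D \<Longrightarrow> U h = C (V (C h))"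
  proof -
    have lin: "clinear_on (C ` D) (\<lambda>h. C (V (C h)))"
      using D V by (auto simp: clinear_on_def csubspace_def conjugation_add[OF C] conjugation_scale[OF C] CC)
    have bound: "norm (C (V (C h))) \<le> norm h" if "h \<in> C ` D" for h
      using that contr by (auto simp: conjugation_norm[OF C] CC)
    show ?thesis by (rule cinner.contractive_extension[OF CD lin bound]) (use that in blast)+
  qed
  obtain U' where U': "clinear_on UNIV U'" "\<And>x. norm (U' x) \<le> norm x"
    "\<And>x y. cinner (U x) y = cinner x (U' y)"
    using contraction_adjoint[OF U(1,2)] by blast
  obtain P where P: "clinear_on UNIV P" "\<And>x. norm (P x) \<le> norm x" "\<And>x. P x \<in> closure (C ` D)"
    "\<And>x f. f \<in> C ` D \<Longrightarrow> cinner (P x) f = cinner x f"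
    using orthogonal_projection[OF CD] by blast
  define R where "R x = P (U' x)" for x
  have R_lin: "clinear_on UNIV R"
    using P(1) U'(1) by (simp add: clinear_on_def R_def)
  have R_norm: "norm (R x) \<le> norm x" for x
    unfolding R_def using P(2) U'(2) order_trans by blast
  have R_cl: "R x \<in> closure (C ` D)" for x unfolding R_def by (rule P(3))
  have R_inner: "cinner (R x) (C f) = cinner x (C (V f))" if "f \<in> D" for x f
  proof -
    have "cinner (R x) (C f) = cinner (U' x) (C f)" unfolding R_def using P(4) that by blast
    also have "\<dots> = cinner x (U (C f))" by (metis U'(3) cinner_commute)
    finally show ?thesis using U(3) that by (simp add: CC)
  qed
  have orth: "cinner (R x) y = 0" if y: "\<And>f. f \<in> D \<Longrightarrow> cinner y (C f) = 0" for x y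
    by (rule orthogonal_closure[OF _ R_cl]) (use y cinner_commute[of _ y] in auto)
  define q where "q x y = cinner x y - cinner (R x) (R y)" for x y
  have q_diag: "Re (q x x) = (norm x)\<^sup>2 - (norm (R x))\<^sup>2" for x
    by (simp add: q_def cinner.seminorm_square)
  interpret q: semi_inner q
  proof
    show "q x y = cnj (q y x)" for x y
      unfolding q_def by (metis cinner_commute complex_cnj_diff)
    show "0 \<le> Re (q x x)" for x
      using power_mono[OF R_norm[of x], of 2] by (simp add: q_diag)
  qed (simp_all add: q_def cinner.bilinear clinear_add[OF R_lin] clinear_scale[OF R_lin] algebra_simps)
  have defect_orth: "cinner (V f - R f) (C g) = 0" if "f \<in> D" "g \<in> D" for f g
    using R_inner[OF that(2), of f] sym[OF that] by (simp add: cinner.bilinear)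
  obtain B where B: "clinear_on UNIV B" "\<And>f. f \<in> D \<Longrightarrow> B f = V f - R f"
    "\<And>x. norm (B x) \<le> q.seminorm x" "\<And>x. B x \<in> closure ((\<lambda>f. V f - R f) ` D)"
  proof (rule q.contractive_extension[OF D])
    show "clinear_on D (\<lambda>f. V f - R f)"
      using V R_lin by (simp add: clinear_on_def complex_space.scale_right_diff_distrib)
    show "norm (V f - R f) \<le> q.seminorm f" if f: "f \<in> D" for f
    proof -
      have "(norm (V f))\<^sup>2 = (norm (R f))\<^sup>2 + (norm (V f - R f))\<^sup>2"
        using norm_add_square[of "R f" "V f - R f"] orth[OF defect_orth[OF f]] by simp
      then have "(norm (V f - R f))\<^sup>2 \<le> Re (q f f)"
        using power_mono[OF contr[OF f], of 2] by (simp add: q_diag)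
      then show ?thesis by (metis q.seminorm_nonneg q.seminorm_square power2_le_imp_le)
    qed
  qed blast
  have B_orth: "cinner (B x) (C g) = 0" if "g \<in> D" for x g
    by (rule orthogonal_closure[OF _ B(4)]) (use defect_orth that in auto)
  show ?thesis
  proof
    show "clinear_on UNIV (\<lambda>x. R x + B x)"
      using R_lin B(1) by (simp add: clinear_on_def scaleC_add_right)
    show "norm (R x + B x) \<le> norm x" for x
    proof (rule power2_le_imp_le)
      have "(norm (B x))\<^sup>2 \<le> Re (q x x)"
        using power_mono[OF B(3)[of x], of 2] by (simp add: q.seminorm_square)
      then show "(norm (R x + B x))\<^sup>2 \<le> (norm x)\<^sup>2"
        using orth[OF B_orth, of x x] by (simp add: norm_add_square q_diag)
    qed simp
    show "R f + B f = V f" if "f \<in> D" for f using B(2)[OF that] by simp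
    show "cinner (R x + B x) (C f) = cinner x (C (V f))" if "f \<in> D" for x f
      using R_inner[OF that] B_orth[OF that] by (simp add: cinner.bilinear)
  qed
qed

text \<open>
  If \<open>W\<close> extends \<open>V\<close> and its adjoint \<open>W'\<close> acts on \<open>C D\<close> as \<open>C V C\<close>, then \<open>C W' C\<close> extends \<open>V\<close> as well.
  The map \<open>W \<mapsto> C W' C\<close> is a norm-preserving involution whose fixed points are the symmetric
  operators, so the mean of \<open>W\<close> and \<open>C W' C\<close> is a symmetric contraction that extends \<open>V\<close>.
\<close>

lemma symmetric_contraction_extension:
  fixes C :: "'a::chilbert_space \<Rightarrow> 'a"
  assumes C: "conjugation C" and D: "csubspace D" and V: "clinear_on D V"
    and contr: "\<And>f. f \<in> D \<Longrightarrow> norm (V f) \<le> norm f"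
    and sym: "\<And>f g. f \<in> D \<Longrightarrow> g \<in> D \<Longrightarrow> cinner (V f) (C g) = cinner f (C (V g))"
  obtains W where "clinear_on UNIV W" "\<And>x. norm (W x) \<le> norm x" "\<And>f. f \<in> D \<Longrightarrow> W f = V f"
    "\<And>x y. cinner (W x) (C y) = cinner x (C (W y))"
proof -
  note CC = conjugation_involution[OF C]
  obtain W where W: "clinear_on UNIV W" "\<And>x. norm (W x) \<le> norm x" "\<And>f. f \<in> D \<Longrightarrow> W f = V f"
    "\<And>x f. f \<in> D \<Longrightarrow> cinner (W x) (C f) = cinner x (C (V f))"
    using Parrott_extension[OF assms] by blast
  obtain W' where W': "clinear_on UNIV W'" "\<And>x. norm (W' x) \<le> norm x"
    "\<And>x y. cinner (W x) y = cinner x (W' y)"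
    using contraction_adjoint[OF W(1,2)] by blast
  define Z where "Z x = (1/2) *\<^sub>C (W x + C (W' (C x)))" for x
  show ?thesis
  proof
    show "clinear_on UNIV Z"
      using W(1) W'(1)
      by (simp add: clinear_on_def Z_def conjugation_add[OF C] conjugation_scale[OF C] scaleC_add_right
          scaleC_scaleC mult.commute)
    show "norm (Z x) \<le> norm x" for x
    proof -
      have "norm (W x + C (W' (C x))) \<le> norm x + norm x"
        using W(2)[of x] W'(2)[of "C x"] by (intro norm_triangle_mono) (simp_all add: conjugation_norm[OF C])
      then show ?thesis by (simp add: Z_def cinner.seminorm_scale)
    qed
    show "Z f = V f" if f: "f \<in> D" for f
    proof -
      have "W' (C f) = C (V f)" by (rule cinner_ext_left) (simp add: W(4)[OF f] flip: W'(3))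
      then show ?thesis by (simp add: Z_def W(3)[OF f] CC flip: complex_space.scale_left_distrib[of 1 1, simplified])
    qed
    show "cinner (Z x) (C y) = cinner x (C (Z y))" for x y
    proof -
      have swap: "cinner (C (W' (C x))) (C y) = cinner x (C (W y))" for x y
        by (metis C W'(3) cinner_conjugation cinner_conjugation_swap)
      have "cinner (W x) (C y) = cinner x (C (C (W' (C y))))" by (simp add: CC W'(3))
      then show ?thesis
        by (simp add: Z_def conjugation_add[OF C] conjugation_scale[OF C] cinner.bilinear swap add.commute)
    qed
  qed
qed

section \<open>The Cayley transform\<close>

text \<open>
  The vectors \<open>y + \<i> x\<close> and \<open>y - \<i> x\<close> are the argument and the value of the Cayley transform at a point
  \<open>(x, y)\<close> of the graph of an operator; scaled by \<open>- \<i> / 2 = 1 / (2 \<i>)\<close>, they give the parameter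
  \<open>u\<close> and its image \<open>W u\<close> for which \<open>x = (1 - W) u\<close> and \<open>y = \<i> (1 + W) u\<close>.
\<close>

lemma cayley_inversion:
  fixes x y :: "'a::complex_inner"
  shows "x = (- \<i> / 2) *\<^sub>C (y + \<i> *\<^sub>C x) - (- \<i> / 2) *\<^sub>C (y - \<i> *\<^sub>C x)"
    and "y = \<i> *\<^sub>C ((- \<i> / 2) *\<^sub>C (y + \<i> *\<^sub>C x) + (- \<i> / 2) *\<^sub>C (y - \<i> *\<^sub>C x))"
  by (rule cinner_ext, simp add: cinner.bilinear complex_eq_iff field_simps)+

text \<open>
  The operator \<open>\<i> (1 + W) (1 - W)\<^sup>-\<^sup>1\<close>, which is meaningful when \<open>1 - W\<close> is injective.
\<close>

definition inverse_cayley :: "('a::complex_inner \<Rightarrow> 'a) \<Rightarrow> ('a \<rightharpoonup> 'a)" where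
  "inverse_cayley W = (\<lambda>x.
     if x \<in> range (\<lambda>u. u - W u)
     then let u = inv (\<lambda>u. u - W u) x in Some (\<i> *\<^sub>C (u + W u))
     else None)"

lemma inverse_cayley_eq_Some_iff:
  assumes "inj (\<lambda>u. u - W u)"
  shows "inverse_cayley W x = Some y \<longleftrightarrow> (\<exists>u. x = u - W u \<and> y = \<i> *\<^sub>C (u + W u))"
proof -
  have "inv (\<lambda>u. u - W u) (u - W u) = u" for u using inv_f_f[OF assms, of u] by simp
  then show ?thesis by (auto simp: inverse_cayley_def Let_def)
qed

text \<open>
  By symmetry the adjoint of \<open>W\<close> is \<open>C W C\<close>, again a contraction. If \<open>W u = u\<close>, then
  \<open>\<parallel>C W C u - u\<parallel>\<^sup>2 \<le> 2 \<parallel>u\<parallel>\<^sup>2 - 2 Re (u, W u) = 0\<close>, so the adjoint fixes \<open>u\<close> too and \<open>u\<close> is orthogonal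
  to the range of \<open>1 - W\<close>.
\<close>

lemma inj_diff_of_dense_range:
  fixes C :: "'a::complex_inner \<Rightarrow> 'a"
  assumes C: "conjugation C" and W: "clinear_on UNIV W" and contr: "\<And>x. norm (W x) \<le> norm x"
    and sym: "\<And>x y. cinner (W x) (C y) = cinner x (C (W y))"
    and dense: "closure (range (\<lambda>u. u - W u)) = UNIV"
  shows "inj (\<lambda>u. u - W u)"
proof (rule injI)
  fix x y assume "x - W x = y - W y"
  then have fixed: "W (x - y) = x - y" by (simp add: clinear_diff[OF W] algebra_simps)
  define u where "u = x - y"
  have adj: "cinner (W v) u = cinner v (C (W (C u)))" for v
    using sym[of v "C u"] by (simp add: conjugation_involution[OF C])
  have "Re (cinner (C (W (C u))) u) = (norm u)\<^sup>2"
    using adj[of u] fixed cinner.Re_commute[of u] by (simp add: u_def cinner.seminorm_square)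
  moreover have "(norm (C (W (C u))))\<^sup>2 \<le> (norm u)\<^sup>2"
    using contr[of "C u"] by (intro power_mono) (simp_all add: conjugation_norm[OF C])
  ultimately have "(norm (C (W (C u)) - u))\<^sup>2 \<le> 0" by (simp add: norm_diff_square)
  then have "C (W (C u)) = u" by simp
  then have "cinner (v - W v) u = 0" for v using adj[of v] by (simp add: cinner.bilinear)
  then have orth: "cinner f u = 0" if "f \<in> range (\<lambda>u. u - W u)" for f using that by blast
  have "u \<in> closure (range (\<lambda>u. u - W u))" unfolding dense by simp
  then have "cinner u u = 0" by (rule orthogonal_closure[rotated]) (rule orth)
  then show "x = y" by (simp add: cinner_eq_zero_iff u_def)
qed

text \<open>
  At \<open>f = (1 - W) u\<close> the imaginary part of the quadratic form is \<open>\<parallel>u\<parallel>\<^sup>2 - \<parallel>W u\<parallel>\<^sup>2\<close>, so dissipativity is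
  the contractivity of \<open>W\<close>.
\<close>

lemma dissipative_inverse_cayley:
  assumes W: "clinear_on UNIV W" and contr: "\<And>x. norm (W x) \<le> norm x"
    and inj: "inj (\<lambda>u. u - W u)"
  shows "dissipative (inverse_cayley W)"
  unfolding dissipative_def linear_operator_def
proof (intro conjI allI impI ballI)
  note S = inverse_cayley_eq_Some_iff[OF inj]
  have W0: "W 0 = 0" using clinear_diff[OF W, of 0 0] by simp
  show "inverse_cayley W 0 = Some 0" unfolding S by (rule exI[of _ 0]) (simp add: W0)
  show "inverse_cayley W (x + y) = Some (u + v)"
    if xy: "inverse_cayley W x = Some u" "inverse_cayley W y = Some v" for x y u v
  proof -
    obtain f g where "x = f - W f" "u = \<i> *\<^sub>C (f + W f)" "y = g - W g" "v = \<i> *\<^sub>C (g + W g)"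
      using xy unfolding S by blast
    then show ?thesis unfolding S
      by (intro exI[of _ "f + g"]) (simp add: clinear_add[OF W] scaleC_add_right)
  qed
  show "inverse_cayley W (a *\<^sub>C x) = Some (a *\<^sub>C u)" if xu: "inverse_cayley W x = Some u" for a x u
  proof -
    obtain f where "x = f - W f" "u = \<i> *\<^sub>C (f + W f)" using xu unfolding S by blast
    then show ?thesis unfolding S
      by (intro exI[of _ "a *\<^sub>C f"])
        (simp add: clinear_scale[OF W] scaleC_add_right scaleC_scaleC mult.commute
          complex_space.scale_right_diff_distrib)
  qed
  show "0 \<le> Im (cinner (the (inverse_cayley W f)) f)" if f: "f \<in> dom (inverse_cayley W)" for f
  proof -
    obtain y where y: "inverse_cayley W f = Some y" using f by blast
    then obtain u where u: "f = u - W u" "y = \<i> *\<^sub>C (u + W u)" unfolding S by blast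
    have "Im (cinner y f) = (norm u)\<^sup>2 - (norm (W u))\<^sup>2"
      using cinner.Re_commute[of u "W u"] by (simp add: u cinner.bilinear cinner.seminorm_square)
    then show ?thesis using power_mono[OF contr[of u], of 2] by (simp add: y)
  qed
qed

text \<open>
  Both inequalities come from \<open>\<parallel>y \<plusminus> \<i> x\<parallel>\<^sup>2 = \<parallel>y\<parallel>\<^sup>2 + \<parallel>x\<parallel>\<^sup>2 \<plusminus> 2 Im (y, x)\<close>. The first makes \<open>T + \<i>\<close> injective,
  the second makes the Cayley transform contractive.
\<close>

lemma dissipative_norm_square:
  assumes "dissipative T" "T x = Some y"
  shows "(norm y)\<^sup>2 + (norm x)\<^sup>2 \<le> (norm (y + \<i> *\<^sub>C x))\<^sup>2"
    and "norm (y - \<i> *\<^sub>C x) \<le> norm (y + \<i> *\<^sub>C x)"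
proof -
  have "x \<in> dom T" using assms(2) by blast
  then have "0 \<le> Im (cinner (the (T x)) x)" using assms(1) unfolding dissipative_def by blast
  then have Im: "0 \<le> Im (cinner y x)" by (simp add: assms(2))
  then show "(norm y)\<^sup>2 + (norm x)\<^sup>2 \<le> (norm (y + \<i> *\<^sub>C x))\<^sup>2"
    by (simp add: norm_add_square cinner.bilinear cinner.seminorm_scale)
  show "norm (y - \<i> *\<^sub>C x) \<le> norm (y + \<i> *\<^sub>C x)"
    by (rule power2_le_imp_le)
      (use Im in \<open>simp_all add: norm_add_square norm_diff_square cinner.bilinear\<close>)
qed

lemma linear_operator_diff:
  assumes "linear_operator T" "T x = Some u" "T y = Some v"
  shows "T (x - y) = Some (u - v)"
proof -
  have "T ((-1) *\<^sub>C y) = Some ((-1) *\<^sub>C v)" using assms unfolding linear_operator_def by blast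
  then have "T (x + (-1) *\<^sub>C y) = Some (u + (-1) *\<^sub>C v)"
    using assms unfolding linear_operator_def by blast
  then show ?thesis by simp
qed

lemma dissipative_inj:
  assumes T: "dissipative T" and "T x = Some u" "T y = Some v"
    and eq: "u + \<i> *\<^sub>C x = v + \<i> *\<^sub>C y"
  shows "x = y"
proof -
  have "T (x - y) = Some (u - v)" using assms linear_operator_diff unfolding dissipative_def by blast
  then have "(norm (u - v))\<^sup>2 + (norm (x - y))\<^sup>2 \<le> (norm (u - v + \<i> *\<^sub>C (x - y)))\<^sup>2"
    by (rule dissipative_norm_square(1)[OF T])
  also have "u - v + \<i> *\<^sub>C (x - y) = 0"
    using eq by (simp add: complex_space.scale_right_diff_distrib algebra_simps)
  finally show ?thesis by (simp add: sum_power2_le_zero_iff)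
qed

text \<open>
  The operator \<open>S + \<i>\<close> with \<open>S = \<i> (1 + W) (1 - W)\<^sup>-\<^sup>1\<close> maps \<open>(1 - W) u\<close> to \<open>2 \<i> u\<close>, hence is onto. For a
  dissipative extension \<open>S'\<close> the operator \<open>S' + \<i>\<close> is still injective, so it cannot have a larger domain.
\<close>

lemma maximal_dissipative_inverse_cayley:
  assumes W: "clinear_on UNIV W" and contr: "\<And>x. norm (W x) \<le> norm x"
    and inj: "inj (\<lambda>u. u - W u)"
  shows "maximal_dissipative (inverse_cayley W)"
  unfolding maximal_dissipative_def
proof (intro conjI allI impI)
  note S = inverse_cayley_eq_Some_iff[OF inj]
  show "dissipative (inverse_cayley W)" by (rule dissipative_inverse_cayley[OF assms])
  fix S' assume S': "dissipative S'" and sub: "inverse_cayley W \<subseteq>\<^sub>m S'"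
  have sub': "S' x = Some y" if "inverse_cayley W x = Some y" for x y
    using sub that unfolding map_le_def by (metis domI)
  have "inverse_cayley W x = Some y" if y: "S' x = Some y" for x y
  proof -
    define u where "u = (- \<i> / 2) *\<^sub>C (y + \<i> *\<^sub>C x)"
    have "inverse_cayley W (u - W u) = Some (\<i> *\<^sub>C (u + W u))" using S by blast
    moreover from sub'[OF this] have "x = u - W u"
    proof (rule dissipative_inj[OF S' y])
      show "y + \<i> *\<^sub>C x = \<i> *\<^sub>C (u + W u) + \<i> *\<^sub>C (u - W u)"
        by (rule cinner_ext) (simp add: cinner.bilinear u_def algebra_simps)
    qed
    ultimately show ?thesis using sub' y by (metis option.inject)
  qed
  then show "S' = inverse_cayley W" using sub' by (intro ext) (metis option.exhaust)
qed

text \<open>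
  Testing a pair \<open>(x, y)\<close> against the graph of \<open>S\<close> amounts, after moving \<open>W\<close> across the inner product
  by symmetry, to the equation \<open>\<i> (1 + W) x = (1 - W) y\<close>, since the test vector \<open>u\<close> is arbitrary.
  This equation describes the graph of \<open>S\<close> itself.
\<close>

lemma C_self_adjoint_inverse_cayley:
  fixes C :: "'a::complex_inner \<Rightarrow> 'a"
  assumes C: "conjugation C" and W: "clinear_on UNIV W" and contr: "\<And>x. norm (W x) \<le> norm x"
    and sym: "\<And>x y. cinner (W x) (C y) = cinner x (C (W y))"
    and dense: "closure (range (\<lambda>u. u - W u)) = UNIV"
  shows "C_self_adjoint C (inverse_cayley W)"
proof -
  note CC = conjugation_involution[OF C]
  have C_inj: "C a = C b \<longleftrightarrow> a = b" for a b by (metis CC)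
  have inj: "inj (\<lambda>u. u - W u)" by (rule inj_diff_of_dense_range[OF assms])
  note S = inverse_cayley_eq_Some_iff[OF inj]
  let ?S = "inverse_cayley W"
  have dom: "dom ?S = range (\<lambda>u. u - W u)"
    by (auto simp: inverse_cayley_def Let_def split: if_splits)
  have the_S: "the (?S (u - W u)) = \<i> *\<^sub>C (u + W u)" for u
    using S[of "u - W u" "\<i> *\<^sub>C (u + W u)"] by auto
  have graph: "?S x = Some y \<longleftrightarrow> (\<forall>f\<in>dom ?S. cinner (the (?S f)) (C x) = cinner f (C y))" for x y
  proof -
    have "(\<forall>f\<in>dom ?S. cinner (the (?S f)) (C x) = cinner f (C y))
      \<longleftrightarrow> (\<forall>u. cinner (\<i> *\<^sub>C (u + W u)) (C x) = cinner (u - W u) (C y))"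
      by (simp add: dom the_S)
    also have "\<dots> \<longleftrightarrow> (\<forall>u. cinner u (C (\<i> *\<^sub>C (x + W x))) = cinner u (C (y - W y)))"
      by (simp add: cinner.bilinear sym conjugation_add[OF C] conjugation_diff[OF C] conjugation_scale[OF C])
    also have "\<dots> \<longleftrightarrow> C (\<i> *\<^sub>C (x + W x)) = C (y - W y)"
      by (metis cinner_ext_left)
    also have "\<dots> \<longleftrightarrow> \<i> *\<^sub>C (x + W x) = y - W y" by (metis CC)
    also have "\<dots> \<longleftrightarrow> (\<exists>u. x = u - W u \<and> y = \<i> *\<^sub>C (u + W u))"
    proof
      assume eq: "\<i> *\<^sub>C (x + W x) = y - W y"
      define u where "u = (- \<i> / 2) *\<^sub>C (y + \<i> *\<^sub>C x)"
      have "W y + \<i> *\<^sub>C W x = y - \<i> *\<^sub>C x"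
        using eq by (simp add: scaleC_add_right algebra_simps)
      then have Wu: "W u = (- \<i> / 2) *\<^sub>C (y - \<i> *\<^sub>C x)"
        by (simp only: u_def clinear_add[OF W] clinear_scale[OF W])
      have "x = u - W u" "y = \<i> *\<^sub>C (u + W u)"
        unfolding Wu unfolding u_def by (rule cayley_inversion)+
      then show "\<exists>u. x = u - W u \<and> y = \<i> *\<^sub>C (u + W u)" by blast
    next
      assume "\<exists>u. x = u - W u \<and> y = \<i> *\<^sub>C (u + W u)"
      then show "\<i> *\<^sub>C (x + W x) = y - W y"
        by (auto simp: clinear_add[OF W] clinear_diff[OF W] clinear_scale[OF W]
            complex_space.scale_right_diff_distrib scaleC_add_right)
    qed
    finally show ?thesis unfolding S by blast
  qed
  have adjoint: "adjoint_op ?S (C x) = Some z \<longleftrightarrow> ?S x = Some (C z)" for x z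
  proof -
    let ?P = "\<lambda>z. \<forall>f\<in>dom ?S. cinner (the (?S f)) (C x) = cinner f z"
    have P: "?P z \<longleftrightarrow> ?S x = Some (C z)" for z using graph[of x "C z"] by (simp add: CC)
    have unique: "(THE z. ?P z) = z" if "?S x = Some (C z)" for z
      using that unfolding P by (intro the_equality) (auto simp: C_inj)
    show ?thesis
      unfolding adjoint_op_def using unique by (auto simp: P C_inj)
  qed
  have "?S = conj_op C (adjoint_op ?S)"
  proof
    fix x
    show "?S x = conj_op C (adjoint_op ?S) x"
    proof (cases "?S x")
      case None
      then have "adjoint_op ?S (C x) = None" using adjoint[of x] by (cases "adjoint_op ?S (C x)") auto
      then show ?thesis using None by (simp add: conj_op_def)
    next
      case (Some y)
      then show ?thesis using adjoint[of x "C y"] by (simp add: conj_op_def CC)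
    qed
  qed
  moreover have "linear_operator ?S"
    using dissipative_inverse_cayley[OF W contr inj] by (simp add: dissipative_def)
  ultimately show ?thesis using dense by (simp add: C_self_adjoint_def densely_defined_def dom)
qed

text \<open>
  Written with the bilinear form \<open>[x, y] = (x, C y)\<close>, symmetry of \<open>T\<close> reads \<open>[T x, u] = [x, T u]\<close>, and
  the mixed terms of \<open>[(T - \<i>) x, (T + \<i>) u]\<close> and \<open>[(T + \<i>) x, (T - \<i>) u]\<close> then cancel, so that symmetry
  is inherited by the transform.
\<close>

lemma cayley_transform:
  fixes C :: "'a::complex_inner \<Rightarrow> 'a"
  assumes C: "conjugation C" and sym: "C_symmetric C T" and diss: "dissipative T"
  obtains D V where "csubspace D" "clinear_on D V" "\<And>f. f \<in> D \<Longrightarrow> norm (V f) \<le> norm f"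
    "\<And>f g. f \<in> D \<Longrightarrow> g \<in> D \<Longrightarrow> cinner (V f) (C g) = cinner f (C (V g))"
    "\<And>x y. T x = Some y \<Longrightarrow> y + \<i> *\<^sub>C x \<in> D \<and> V (y + \<i> *\<^sub>C x) = y - \<i> *\<^sub>C x"
proof -
  have T0: "T 0 = Some 0"
    and T_add: "\<And>x y u v. T x = Some u \<Longrightarrow> T y = Some v \<Longrightarrow> T (x + y) = Some (u + v)"
    and T_scale: "\<And>a x u. T x = Some u \<Longrightarrow> T (a *\<^sub>C x) = Some (a *\<^sub>C u)"
    using diss unfolding dissipative_def linear_operator_def by blast+
  define D where "D = {y + \<i> *\<^sub>C x |x y. T x = Some y}"
  define V where "V f = f - (2 * \<i>) *\<^sub>C (THE x. \<exists>y. T x = Some y \<and> f = y + \<i> *\<^sub>C x)" for f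
  have V: "V (y + \<i> *\<^sub>C x) = y - \<i> *\<^sub>C x" if "T x = Some y" for x y
  proof -
    have the_x: "(THE x'. \<exists>y'. T x' = Some y' \<and> y + \<i> *\<^sub>C x = y' + \<i> *\<^sub>C x') = x"
      using that dissipative_inj[OF diss] by (intro the_equality) blast+
    show ?thesis unfolding V_def the_x by (rule cinner_ext) (simp add: cinner.bilinear)
  qed
  have D_cases: "\<exists>x y. T x = Some y \<and> f = y + \<i> *\<^sub>C x" if "f \<in> D" for f
    using that by (auto simp: D_def)
  have D_I: "y + \<i> *\<^sub>C x \<in> D" if "T x = Some y" for x y using that by (auto simp: D_def)
  have sum: "y + \<i> *\<^sub>C x + (v + \<i> *\<^sub>C u) = (y + v) + \<i> *\<^sub>C (x + u)" for x y u v :: 'a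
    by (simp add: scaleC_add_right)
  have scale: "a *\<^sub>C (y + \<i> *\<^sub>C x) = a *\<^sub>C y + \<i> *\<^sub>C (a *\<^sub>C x)" for a and x y :: 'a
    by (simp add: scaleC_add_right scaleC_scaleC mult.commute)
  show ?thesis
  proof
    have "f + g \<in> D \<and> V (f + g) = V f + V g" if fg: "f \<in> D" "g \<in> D" for f g
    proof -
      obtain x y u v where xy: "T x = Some y" "f = y + \<i> *\<^sub>C x" "T u = Some v" "g = v + \<i> *\<^sub>C u"
        using D_cases fg by meson
      show ?thesis using D_I[OF T_add[OF xy(1,3)]] V[OF T_add[OF xy(1,3)]]
        unfolding xy(2,4) V[OF xy(1)] V[OF xy(3)] sum by (simp add: scaleC_add_right)
    qed
    moreover have "a *\<^sub>C f \<in> D \<and> V (a *\<^sub>C f) = a *\<^sub>C V f" if f: "f \<in> D" for a f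
    proof -
      obtain x y where xy: "T x = Some y" "f = y + \<i> *\<^sub>C x" using D_cases f by meson
      show ?thesis using D_I[OF T_scale[OF xy(1), of a]] V[OF T_scale[OF xy(1), of a]]
        unfolding xy(2) V[OF xy(1)] scale
        by (simp add: scaleC_scaleC complex_space.scale_right_diff_distrib mult.commute)
    qed
    moreover have "0 \<in> D" using T0 by (force simp: D_def)
    ultimately show "csubspace D" "clinear_on D V" by (simp_all add: csubspace_def clinear_on_def)
    show "norm (V f) \<le> norm f" if "f \<in> D" for f
      using D_cases[OF that] V dissipative_norm_square(2)[OF diss] by force
    show "cinner (V f) (C g) = cinner f (C (V g))" if fg: "f \<in> D" "g \<in> D" for f g
    proof -
      obtain x y u v where xy: "T x = Some y" "f = y + \<i> *\<^sub>C x" "T u = Some v" "g = v + \<i> *\<^sub>C u"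
        using D_cases fg by meson
      have "cinner y (C u) = cinner x (C v)"
        using sym xy(1,3) unfolding C_symmetric_def by (metis domI option.sel)
      then show ?thesis unfolding xy(2,4) V[OF xy(1)] V[OF xy(3)]
        by (simp add: conjugation_add[OF C] conjugation_diff[OF C] conjugation_scale[OF C]
            cinner.bilinear algebra_simps)
    qed
    show "y + \<i> *\<^sub>C x \<in> D \<and> V (y + \<i> *\<^sub>C x) = y - \<i> *\<^sub>C x" if "T x = Some y" for x y
      using V[OF that] that by (auto simp: D_def)
  qed
qed

theorem theorem1p1:
  fixes C :: "'a::chilbert_space \<Rightarrow> 'a" and T :: "'a \<rightharpoonup> 'a"
  assumes "conjugation C"
    and "densely_defined T"
    and "C_symmetric C T"
    and "dissipative T"
  shows "\<exists>S. T \<subseteq>\<^sub>m S \<and> C_self_adjoint C S \<and> maximal_dissipative S"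
proof -
  note C = assms(1)
  obtain D V where D: "csubspace D" "clinear_on D V" "\<And>f. f \<in> D \<Longrightarrow> norm (V f) \<le> norm f"
    "\<And>f g. f \<in> D \<Longrightarrow> g \<in> D \<Longrightarrow> cinner (V f) (C g) = cinner f (C (V g))"
    and V: "\<And>x y. T x = Some y \<Longrightarrow> y + \<i> *\<^sub>C x \<in> D \<and> V (y + \<i> *\<^sub>C x) = y - \<i> *\<^sub>C x"
    using cayley_transform[OF C assms(3,4)] by metis
  obtain W where W: "clinear_on UNIV W" "\<And>x. norm (W x) \<le> norm x"
    and W_V: "\<And>f. f \<in> D \<Longrightarrow> W f = V f"
    and sym: "\<And>x y. cinner (W x) (C y) = cinner x (C (W y))"
    using symmetric_contraction_extension[OF C D] by metis
  have graph: "\<exists>u. x = u - W u \<and> y = \<i> *\<^sub>C (u + W u)" if "T x = Some y" for x y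
  proof (intro exI conjI)
    define u where "u = (- \<i> / 2) *\<^sub>C (y + \<i> *\<^sub>C x)"
    have Wu: "W u = (- \<i> / 2) *\<^sub>C (y - \<i> *\<^sub>C x)"
      using V[OF that] W_V by (simp only: u_def clinear_scale[OF W(1)])
    show "x = u - W u" "y = \<i> *\<^sub>C (u + W u)"
      unfolding Wu unfolding u_def by (rule cayley_inversion)+
  qed
  have "dom T \<subseteq> range (\<lambda>u. u - W u)" using graph by blast
  then have dense: "closure (range (\<lambda>u. u - W u)) = UNIV"
    using assms(2) closure_mono unfolding densely_defined_def by blast
  have inj: "inj (\<lambda>u. u - W u)" by (rule inj_diff_of_dense_range[OF C W sym dense])
  have "T \<subseteq>\<^sub>m inverse_cayley W"
    unfolding map_le_def using graph inverse_cayley_eq_Some_iff[OF inj] by (metis domD)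
  then show ?thesis
    using C_self_adjoint_inverse_cayley[OF C W sym dense]
      maximal_dissipative_inverse_cayley[OF W inj] by blast
qed

end
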